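(* Let $Q$, $A$, $B$, $C_Q$, $c(t)$, $c^\perp(t)$ be as in the context. Let $c_1,c_2\in C_Q$, $b\in\mathbb{R}^2$, and let $a\in\mathbb{R}^2$ be such that $Q(\nu)\neq0$ for all $\nu\in a+\mathbb{Z}^2$. Then, as functions on $\mathbb{H}$, \begin{equation*} \widehat{\Phi}_{a,b}^{c_1,c_2} = \Phi_{a,b}^{c_1,c_2} + \phi_{a,b}^{c_1} - \phi_{a,b}^{c_2}. \end{equation*}
   Context: $A$ is a symmetric $2\times 2$ integer matrix such that $Q(\nu)=\frac12\nu^tA\nu$ on $\mathbb{R}^2$ has signature $(1,1)$; $B(\nu,\mu)=\nu^tA\mu$. $C_Q$ is a fixed one of the two components of $\{c\in\mathbb{R}^2:Q(c)=-1\}$. Choose $P\in\mathrm{GL}_2(\mathbb{R})$ with $A=P^t\begin{pmatrix}0&1\\1&0\end{pmatrix}P$ and $P^{-1}\binom{1}{-1}\in C_Q$; set $c(t)=P^{-1}\binom{e^t}{-e^{-t}}$, $c^\perp(t)=P^{-1}\binom{e^t}{e^{-t}}$. For $c_i\in C_Q$, $t_i$ is defined by $c(t_i)=c_i$ and $c_i^\perp:=c^\perp(t_i)$. $K_0$ is the modified Bessel function of the second kind, $\tau=x+iy\in\mathbb{H}$, $q=e^{2\pi i\tau}$, $\mathrm{sgn}(0)=0$. Define \begin{equation*} \begin{split} \Phi_{a,b}^{c_1,c_2}(\tau)&=\mathrm{sgn}(t_2-t_1)\,y^{1/2}\sum_{\nu\in a+\mathbb{Z}^2}\tfrac12\bigl[1-\mathrm{sgn}(B(\nu,c_1)B(\nu,c_2))\bigr]e^{2\pi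 iQ(\nu)x}e^{2\pi iB(\nu,b)}K_0(2\pi Q(\nu)y)\\ &\quad+\mathrm{sgn}(t_2-t_1)\,y^{1/2}\sum_{\nu\in a+\mathbb{Z}^2}\tfrac12\bigl[1-\mathrm{sgn}(B(\nu,c_1^\perp)B(\nu,c_2^\perp))\bigr]e^{2\pi iQ(\nu)x}e^{2\pi iB(\nu,b)}K_0(-2\pi Q(\nu)y), \end{split} \end{equation*} \begin{equation*} \widehat{\Phi}^{c_1,c_2}_{a,b}(\tau)=y^{1/2}\sum_{\nu\in a+\mathbb{Z}^2} q^{Q(\nu)}e^{2\pi iB(\nu,b)}\int_{t_1}^{t_2}e^{-\pi yB(\nu,c(t))^2}\,dt, \end{equation*} and for $c_0=c(t_0)\in C_Q$, $c_0^\perp=c^\perp(t_0)$, \begin{equation*} \phi_{a,b}^{c_0}(\tau)=y^{1/2}\sum_{\nu\in a+\mathbb{Z}^2}\alpha_{t_0}(\nu y^{1/2})\,q^{Q(\nu)}e^{2\pi iB(\nu,b)}, \end{equation*} where $\alpha_{t_0}(\nu)=\int_{t_0}^\infty e^{-\pi B(\nu,c(t))^2}dt$ if $B(\nu,c_0)B(\nu,c_0^\perp)>0$, $\alpha_{t_0}(\nu)=-\int_{-\infty}^{t_0}e^{-\pi B(\nu,c(t))^2}dt$ if $B(\nu,c_0)B(\nu,c_0^\perp)<0$, and $\alpha_{t_0}(\nu)=0$ if $B(\nu,c_0)B(\nu,c_0^\perp)=0$. *)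

theory Defs
  imports "HOL-Analysis.Analysis"
begin

text \<open>
  Indices of inertia of a quadratic form \<open>q\<close>: the maximal dimension of a subspace on which
  \<open>q\<close> is positive definite, and likewise for \<open>- q\<close>.
\<close>

definition positive_index :: "('a::euclidean_space \<Rightarrow> real) \<Rightarrow> nat" where
  "positive_index q = Max {dim V | V. subspace V \<and> (\<forall>v\<in>V. v \<noteq> 0 \<longrightarrow> q v > 0)}"

definition has_signature :: "('a::euclidean_space \<Rightarrow> real) \<Rightarrow> nat \<Rightarrow> nat \<Rightarrow> bool" where
  "has_signature q m n \<longleftrightarrow> positive_index q = m \<and> positive_index (\<lambda>v. - q v) = n"

definition bilin :: "int^2^2 \<Rightarrow> real^2 \<Rightarrow> real^2 \<Rightarrow> real" where
  "bilin A \<nu> \<mu> = \<nu> \<bullet> (map_matrix real_of_int A *v \<mu>)"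

definition quad :: "int^2^2 \<Rightarrow> real^2 \<Rightarrow> real" where
  "quad A \<nu> = 1 / 2 * (\<nu> \<bullet> (map_matrix real_of_int A *v \<nu>))"

definition hyp_matrix :: "real^2^2" where
  "hyp_matrix = vector [vector [0, 1], vector [1, 0]]"

definition c_curve :: "real^2^2 \<Rightarrow> real \<Rightarrow> real^2" where
  "c_curve P t = matrix_inv P *v vector [exp t, - exp (- t)]"

definition c_perp_curve :: "real^2^2 \<Rightarrow> real \<Rightarrow> real^2" where
  "c_perp_curve P t = matrix_inv P *v vector [exp t, exp (- t)]"

definition c_param :: "real^2^2 \<Rightarrow> real^2 \<Rightarrow> real" where
  "c_param P c = (THE t. c_curve P t = c)"

definition c_perp :: "real^2^2 \<Rightarrow> real^2 \<Rightarrow> real^2" where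
  "c_perp P c = c_perp_curve P (c_param P c)"

definition lattice_coset :: "real^2 \<Rightarrow> (real^2) set" where
  "lattice_coset a = (+) a ` {m. \<forall>i. m $ i \<in> \<int>}"

text \<open>
  The modified Bessel function \<open>K\<^sub>0\<close> for positive real argument. Only positive arguments
  matter below: in both sums defining \<open>Phi\<close> the bracketed coefficient vanishes at every
  \<open>\<nu>\<close> with \<open>quad A \<nu> \<noteq> 0\<close> for which the argument is negative.
\<close>

definition bessel_K0 :: "real \<Rightarrow> real" where
  "bessel_K0 x = (LBINT u=0..\<infinity>. exp (- x * cosh u))"

text \<open>
  \<open>qpow \<tau> r\<close> is \<open>q\<close> to the power \<open>r\<close> with \<open>q = exp (2 \<pi> \<i> \<tau>)\<close>; for non-integral \<open>r\<close> this
  is not the principal branch \<open>q powr r\<close>.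
\<close>

definition qpow :: "complex \<Rightarrow> real \<Rightarrow> complex" where
  "qpow \<tau> r = exp (2 * of_real pi * \<i> * \<tau> * of_real r)"

definition e2pi :: "real \<Rightarrow> complex" where
  "e2pi r = exp (2 * of_real pi * \<i> * of_real r)"

definition Phi ::
  "int^2^2 \<Rightarrow> real^2^2 \<Rightarrow> real^2 \<Rightarrow> real^2 \<Rightarrow> real^2 \<Rightarrow> real^2 \<Rightarrow> complex \<Rightarrow> complex" where
  "Phi A P a b c1 c2 \<tau> =
     of_real (sgn (c_param P c2 - c_param P c1) * sqrt (Im \<tau>)) *
       (\<Sum>\<^sub>\<infinity>\<nu>\<in>lattice_coset a.
          of_real (1 / 2 * (1 - sgn (bilin A \<nu> c1 * bilin A \<nu> c2))) *
          e2pi (quad A \<nu> * Re \<tau>) * e2pi (bilin A \<nu> b) *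
          of_real (bessel_K0 (2 * pi * quad A \<nu> * Im \<tau>)))
     + of_real (sgn (c_param P c2 - c_param P c1) * sqrt (Im \<tau>)) *
       (\<Sum>\<^sub>\<infinity>\<nu>\<in>lattice_coset a.
          of_real (1 / 2 * (1 - sgn (bilin A \<nu> (c_perp P c1) * bilin A \<nu> (c_perp P c2)))) *
          e2pi (quad A \<nu> * Re \<tau>) * e2pi (bilin A \<nu> b) *
          of_real (bessel_K0 (- 2 * pi * quad A \<nu> * Im \<tau>)))"

definition Phi_hat ::
  "int^2^2 \<Rightarrow> real^2^2 \<Rightarrow> real^2 \<Rightarrow> real^2 \<Rightarrow> real^2 \<Rightarrow> real^2 \<Rightarrow> complex \<Rightarrow> complex" where
  "Phi_hat A P a b c1 c2 \<tau> =
     of_real (sqrt (Im \<tau>)) *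
       (\<Sum>\<^sub>\<infinity>\<nu>\<in>lattice_coset a.
          qpow \<tau> (quad A \<nu>) * e2pi (bilin A \<nu> b) *
          of_real (LBINT t=ereal (c_param P c1)..ereal (c_param P c2).
                     exp (- pi * Im \<tau> * (bilin A \<nu> (c_curve P t))\<^sup>2)))"

definition alpha :: "int^2^2 \<Rightarrow> real^2^2 \<Rightarrow> real \<Rightarrow> real^2 \<Rightarrow> real" where
  "alpha A P t0 \<nu> =
     (let s = bilin A \<nu> (c_curve P t0) * bilin A \<nu> (c_perp_curve P t0) in
      if s > 0 then (LBINT t=ereal t0..\<infinity>. exp (- pi * (bilin A \<nu> (c_curve P t))\<^sup>2))
      else if s < 0 then - (LBINT t=-\<infinity>..ereal t0. exp (- pi * (bilin A \<nu> (c_curve P t))\<^sup>2))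
      else 0)"

definition phi ::
  "int^2^2 \<Rightarrow> real^2^2 \<Rightarrow> real^2 \<Rightarrow> real^2 \<Rightarrow> real^2 \<Rightarrow> complex \<Rightarrow> complex" where
  "phi A P a b c0 \<tau> =
     of_real (sqrt (Im \<tau>)) *
       (\<Sum>\<^sub>\<infinity>\<nu>\<in>lattice_coset a.
          of_real (alpha A P (c_param P c0) (sqrt (Im \<tau>) *\<^sub>R \<nu>)) *
          qpow \<tau> (quad A \<nu>) * e2pi (bilin A \<nu> b))"

end

theory Submission
  imports Defs
begin

text \<open>
  In the coordinates \<open>(u, v) = P \<nu>\<close> we have \<open>Q(\<nu>) = u v\<close> and \<open>B(\<nu>, c(t)) = v e\<^sup>t - u e\<^sup>-\<^sup>t\<close>,
  \<open>B(\<nu>, c\<^sup>\<bottom>(t)) = v e\<^sup>t + u e\<^sup>-\<^sup>t\<close>. Multiplying \<open>exp (- \<pi> y B(\<nu>, c(t))\<^sup>2)\<close> by \<open>\<bar>q\<bar>\<close> to the power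
  \<open>Q(\<nu>)\<close> cancels the indefinite part and leaves the positive weight
  \<open>exp (- \<pi> y (v\<^sup>2 e\<^sup>2\<^sup>t + u\<^sup>2 e\<^sup>-\<^sup>2\<^sup>t))\<close>, which is symmetric about the point \<open>s\<close> where
  \<open>\<bar>v\<bar> e\<^sup>s = \<bar>u\<bar> e\<^sup>-\<^sup>s\<close>; its integral over either half line bounded by \<open>s\<close> is
  \<open>K\<^sub>0(2 \<pi> y \<bar>u v\<bar>) / 2\<close>. The function \<open>\<alpha>\<close> at \<open>t\<^sub>0\<close> integrates from \<open>t\<^sub>0\<close> away from \<open>s\<close>, so the
  integral from \<open>t\<^sub>1\<close> to \<open>t\<^sub>2\<close> differs from the two \<open>\<alpha>\<close>-terms by \<open>K\<^sub>0\<close> times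
  \<open>(sgn (t\<^sub>2 - s) - sgn (t\<^sub>1 - s)) / 2\<close>. This is the coefficient in the first sum of \<open>\<Phi>\<close> if
  \<open>u v > 0\<close> and in the second if \<open>u v < 0\<close>, the other coefficient being zero. The identity thus
  holds term by term. Gaussian bounds make the \<open>\<alpha>\<close>-series and the series of integrals converge
  absolutely; the two \<open>K\<^sub>0\<close>-series have disjoint supports, so they inherit this from the termwise
  identity.
\<close>

section \<open>Half-line integrals of the positive weight\<close>

lemma exp_minus_Ioi:
  fixes a c :: real
  assumes "a > 0"
  shows set_integrable_exp_minus_Ioi: "set_integrable lborel {c<..} (\<lambda>x. exp (- a * x))"
    and set_integral_exp_minus_Ioi: "(LBINT x:{c<..}. exp (- a * x)) = exp (- a * c) / a"
proof -
  have "((\<lambda>x. exp (- a * x)) has_integral exp (- a * c) / a) {c..}"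
    using has_integral_exp_minus_to_infinity[OF assms] .
  then have I: "((\<lambda>x. exp (- a * x)) has_integral exp (- a * c) / a) {c<..}"
    by (subst has_integral_spike_set_eq[where T = "{c..}"])
       (auto intro: negligible_subset[OF negligible_sing[of c]])
  then have "set_integrable lebesgue {c<..} (\<lambda>x. exp (- a * x))"
    by (intro nonnegative_absolutely_integrable_1) (auto simp: integrable_on_def)
  then show *: "set_integrable lborel {c<..} (\<lambda>x. exp (- a * x))"
    unfolding set_integrable_def by (subst (asm) integrable_completion) auto
  show "(LBINT x:{c<..}. exp (- a * x)) = exp (- a * c) / a"
    using set_borel_integral_eq_integral(2)[OF *] I by (simp add: integral_unique)
qed

text \<open>The positive weight, with \<open>k\<close>, \<open>X\<close>, \<open>Y\<close> standing
  for \<open>pi * y\<close>, \<open>v^2\<close>, \<open>u^2\<close>. With \<open>X\<close> and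
  \<open>Y\<close> independent, reflection in \<open>t\<close> swaps them and translation rescales
  them.\<close>

definition hyp_gauss :: "real \<Rightarrow> real \<Rightarrow> real \<Rightarrow> real \<Rightarrow> real" where
  "hyp_gauss k X Y t = exp (- k * (X * exp (2 * t) + Y * exp (- 2 * t)))"

lemma hyp_gauss_pos: "hyp_gauss k X Y t > 0"
  by (simp add: hyp_gauss_def)

lemma hyp_gauss_measurable [measurable]: "hyp_gauss k X Y \<in> borel_measurable borel"
  unfolding hyp_gauss_def by measurable

lemma continuous_on_hyp_gauss: "continuous_on S (hyp_gauss k X Y)"
  unfolding hyp_gauss_def by (intro continuous_intros)

lemma hyp_gauss_minus: "hyp_gauss k X Y (- t) = hyp_gauss k Y X t"
  by (simp add: hyp_gauss_def add.commute)

lemma hyp_gauss_shift: "hyp_gauss k X Y (s + t) = hyp_gauss k (X * exp (2 * s)) (Y * exp (- 2 * s)) t"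
  by (simp add: hyp_gauss_def algebra_simps flip: exp_add)

text \<open>Dropping the \<open>Y\<close> term and replacing the convex function
  \<open>X * exp (2 * t)\<close> by its tangent at \<open>t0\<close> makes the exponent linear in
  \<open>t\<close>, so an explicitly integrable exponential dominates.\<close>

lemma hyp_gauss_Ioi:
  fixes k X Y t0 :: real
  assumes "k > 0" "X > 0" "Y \<ge> 0"
  defines "Z \<equiv> X * exp (2 * t0)"
  shows set_integrable_hyp_gauss_Ioi: "set_integrable lborel {t0<..} (hyp_gauss k X Y)"
    and set_integral_hyp_gauss_Ioi_le:
      "(LBINT t:{t0<..}. hyp_gauss k X Y t) \<le> exp (- k * Z) / (2 * k * Z)"
proof -
  have Z: "Z > 0" using assms by (simp add: Z_def)
  \<comment> \<open>\<open>a\<close> is the slope of the tangent multiplied by \<open>k\<close>, and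
    \<open>C\<close> collects the part of the exponent that is constant in \<open>t\<close>.\<close>
  define a where "a = 2 * k * Z"
  define C where "C = exp (- k * Z + a * t0)"
  have a: "a > 0" using Z assms by (simp add: a_def)
  have le: "hyp_gauss k X Y t \<le> C * exp (- a * t)" for t
  proof -
    have "X * exp (2 * t) + Y * exp (- 2 * t) \<ge> X * exp (2 * t)"
      using assms by simp
    moreover have "X * exp (2 * t) = Z * exp (2 * (t - t0))"
      by (simp add: Z_def flip: exp_add)
    moreover have "Z * exp (2 * (t - t0)) \<ge> Z * (1 + 2 * (t - t0))"
      using Z exp_ge_add_one_self[of "2 * (t - t0)"] by (intro mult_left_mono) auto
    ultimately have "X * exp (2 * t) + Y * exp (- 2 * t) \<ge> Z * (1 + 2 * (t - t0))"
      by linarith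
    then have "k * (X * exp (2 * t) + Y * exp (- 2 * t)) \<ge> k * (Z * (1 + 2 * (t - t0)))"
      using assms(1) by (intro mult_left_mono) auto
    then show ?thesis
      by (simp add: hyp_gauss_def C_def a_def algebra_simps flip: exp_add)
  qed
  have int: "set_integrable lborel {t0<..} (\<lambda>t. C * exp (- a * t))"
    using set_integrable_exp_minus_Ioi[OF a] by (intro set_integrable_mult_right) auto
  show *: "set_integrable lborel {t0<..} (hyp_gauss k X Y)"
    by (rule set_integrable_bound[OF int])
       (use le hyp_gauss_pos in \<open>auto simp: set_borel_measurable_def abs_of_pos intro: order.trans[OF _ abs_ge_self]\<close>)
  have "(LBINT t:{t0<..}. hyp_gauss k X Y t) \<le> (LBINT t:{t0<..}. C * exp (- a * t))"
    using le by (intro set_integral_mono * int)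
  also have "\<dots> = C * (exp (- a * t0) / a)"
    using set_integral_exp_minus_Ioi[OF a] by simp
  also have "\<dots> = exp (- k * Z) / (2 * k * Z)"
    by (simp add: C_def a_def flip: exp_add)
  finally show "(LBINT t:{t0<..}. hyp_gauss k X Y t) \<le> exp (- k * Z) / (2 * k * Z)" .
qed

lemma integrable_hyp_gauss:
  assumes "k > 0" "X > 0" "Y > 0"
  shows "integrable lborel (hyp_gauss k X Y)"
proof -
  \<comment> \<open>Starting at -1 makes the two open half lines overlap, so that together they
    cover the real line.\<close>
  have 1: "set_integrable lborel {-1<..} (hyp_gauss k X Y)"
    using assms by (intro set_integrable_hyp_gauss_Ioi) auto
  have "set_integrable lborel {0<..} (hyp_gauss k Y X)"
    using assms by (intro set_integrable_hyp_gauss_Ioi) auto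
  then have "set_integrable lborel {..<0} (hyp_gauss k X Y)"
    unfolding set_integrable_def
    by (subst (asm) lborel_integrable_real_affine_iff[where c="-1" and t=0, symmetric])
       (auto simp: hyp_gauss_minus indicator_def)
  with 1 have "set_integrable lborel ({-1<..} \<union> {..<0}) (hyp_gauss k X Y)"
    by (rule set_integrable_Un) auto
  also have "{-1<..} \<union> {..<0} = (UNIV :: real set)" by auto
  finally show ?thesis by (simp add: set_integrable_def)
qed

lemma interval_integrable_hyp_gauss:
  assumes "k > 0" "X > 0" "Y > 0"
  shows "interval_lebesgue_integrable lborel p q (hyp_gauss k X Y)"
  using integrable_hyp_gauss[OF assms]
  unfolding interval_lebesgue_integrable_def set_integrable_def
  by (auto intro!: integrable_mult_indicator simp del: real_scaleR_def)

lemma interval_integral_hyp_gauss_add: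
  assumes "k > 0" "X > 0" "Y > 0"
  shows "(LBINT t=p..q. hyp_gauss k X Y t) + (LBINT t=q..r. hyp_gauss k X Y t) =
         (LBINT t=p..r. hyp_gauss k X Y t)"
  by (intro interval_integral_sum interval_integrable_hyp_gauss assms)

lemma interval_integral_hyp_gauss_reflect:
  "(LBINT t=p..q. hyp_gauss k X Y t) = (LBINT t=-q..-p. hyp_gauss k Y X t)"
  by (subst interval_integral_reflect) (simp add: hyp_gauss_minus)

lemma hyp_gauss_tail_bound:
  assumes "k > 0" "X > 0" "Y \<ge> 0"
  shows "\<bar>LBINT t=ereal t0..\<infinity>. hyp_gauss k X Y t\<bar> \<le>
         exp (- k * (X * exp (2 * t0))) / (2 * k * (X * exp (2 * t0)))"
proof -
  have "(LBINT t:{t0<..}. hyp_gauss k X Y t) \<ge> 0"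
    unfolding set_lebesgue_integral_def
    by (intro integral_nonneg_AE AE_I2) (simp add: less_imp_le[OF hyp_gauss_pos])
  then show ?thesis
    using set_integral_hyp_gauss_Ioi_le[OF assms] by (simp add: interval_integral_to_infinity_eq)
qed

text \<open>The hypotheses make \<open>s\<close> the balance point, where both exponential terms
  equal \<open>m\<close>. The exponent is then \<open>- 2 * k * m * cosh (2 * (t - s))\<close>, and
  \<open>x = 2 * (t - s)\<close> gives the integral of \<open>bessel_K0\<close> with Jacobian
  1/2.\<close>

lemma hyp_gauss_half_line:
  assumes eq: "X * exp (2 * s) = m" "Y * exp (- 2 * s) = m"
  shows "(LBINT t=ereal s..\<infinity>. hyp_gauss k X Y t) = bessel_K0 (2 * k * m) / 2"
proof -
  have *: "hyp_gauss k X Y (s + 1 / 2 * x) = exp (- (2 * k * m) * cosh x)" for x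
    unfolding hyp_gauss_shift eq by (simp add: hyp_gauss_def cosh_def field_simps)
  have "(LBINT t=ereal s..\<infinity>. hyp_gauss k X Y t) =
        (\<integral>t. indicator {s<..} t * hyp_gauss k X Y t \<partial>lborel)"
    by (simp add: interval_integral_to_infinity_eq set_lebesgue_integral_def)
  also have "\<dots> = 1 / 2 * (\<integral>x. indicator {0<..} x * exp (- (2 * k * m) * cosh x) \<partial>lborel)"
    by (subst lborel_integral_real_affine[where c="1/2" and t=s])
       (auto simp: * indicator_def simp del: times_divide_eq_left intro!: Bochner_Integration.integral_cong)
  also have "\<dots> = bessel_K0 (2 * k * m) / 2"
    by (simp add: bessel_K0_def zero_ereal_def interval_integral_to_infinity_eq set_lebesgue_integral_def)
  finally show ?thesis .
qed

lemma hyp_gauss_lower_half_line: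
  assumes eq: "X * exp (2 * s) = m" "Y * exp (- 2 * s) = m"
  shows "(LBINT t=-\<infinity>..ereal s. hyp_gauss k X Y t) = bessel_K0 (2 * k * m) / 2"
  using hyp_gauss_half_line[of Y "-s" m X k] assms
  by (subst interval_integral_hyp_gauss_reflect) simp

section \<open>The identity for a single lattice vector\<close>

text \<open>This is \<open>alpha\<close> with the factor \<open>exp (2 * pi * y * Q)\<close>
  removed. The comparison tells on which side of the balance point \<open>t0\<close> lies.\<close>

definition hyp_tail :: "real \<Rightarrow> real \<Rightarrow> real \<Rightarrow> real \<Rightarrow> real" where
  "hyp_tail k X Y t0 =
     (if X * exp (2 * t0) > Y * exp (- 2 * t0) then LBINT t=ereal t0..\<infinity>. hyp_gauss k X Y t
      else if X * exp (2 * t0) < Y * exp (- 2 * t0) then - (LBINT t=-\<infinity>..ereal t0. hyp_gauss k X Y t)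
      else 0)"

text \<open>Each half line bounded by the balance point \<open>s\<close> has mass
  \<open>K / 2\<close>. Hence the tail at \<open>t\<close> is this mass, with a sign, minus the
  integral from \<open>s\<close> to \<open>t\<close>; taking the difference at \<open>t1\<close> and
  \<open>t2\<close> eliminates \<open>s\<close>.\<close>

lemma interval_integral_eq_hyp_tail:
  assumes "k > 0" "X > 0" "Y > 0"
  shows "(LBINT t=ereal t1..ereal t2. hyp_gauss k X Y t) =
     (sgn (X * exp (2 * t2) - Y * exp (- 2 * t2)) - sgn (X * exp (2 * t1) - Y * exp (- 2 * t1))) / 2
       * bessel_K0 (2 * k * sqrt (X * Y)) + hyp_tail k X Y t1 - hyp_tail k X Y t2"
proof -
  \<comment> \<open>The solution of \<open>X * exp (2 * s) = Y * exp (- 2 * s)\<close>; the common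
    value is \<open>sqrt (X * Y)\<close>.\<close>
  define s where "s = ln (Y / X) / 4"
  define K where "K = bessel_K0 (2 * k * sqrt (X * Y))"
  have exps: "exp (2 * s) = sqrt (Y / X)"
  proof -
    have "exp (2 * s) ^ 2 = exp (ln (Y / X))"
      unfolding s_def by (simp flip: exp_double)
    then show ?thesis
      using assms by (intro real_sqrt_unique[symmetric]) auto
  qed
  have eq: "X * exp (2 * s) = sqrt (X * Y)" "Y * exp (- 2 * s) = sqrt (X * Y)"
    using assms unfolding minus_mult_left[symmetric] exp_minus exps
    by (auto intro!: real_sqrt_unique[symmetric]
             simp: power_mult_distrib power2_eq_square[of X] power2_eq_square[of Y] power_inverse)
  have upper: "(LBINT t=ereal s..\<infinity>. hyp_gauss k X Y t) = K / 2"
    unfolding K_def by (intro hyp_gauss_half_line eq)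
  have lower: "(LBINT t=-\<infinity>..ereal s. hyp_gauss k X Y t) = K / 2"
    unfolding K_def by (intro hyp_gauss_lower_half_line eq)
  note add = interval_integral_hyp_gauss_add[OF assms]
  have tail: "hyp_tail k X Y t = sgn (X * exp (2 * t) - Y * exp (- 2 * t)) * K / 2
                - (LBINT x=ereal s..ereal t. hyp_gauss k X Y x)" for t
  proof (cases t s rule: linorder_cases)
    case less
    have "X * exp (2 * t) < X * exp (2 * s)" "Y * exp (- 2 * s) < Y * exp (- 2 * t)"
      using less assms by auto
    then show ?thesis
      using add[of "-\<infinity>" "ereal s" "ereal t"] lower eq by (simp add: hyp_tail_def)
  next
    case equal
    then show ?thesis
      using eq by (simp add: hyp_tail_def)
  next
    case greater
    have "X * exp (2 * t) > X * exp (2 * s)" "Y * exp (- 2 * s) > Y * exp (- 2 * t)"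
      using greater assms by auto
    then show ?thesis
      using add[of "ereal s" "ereal t" \<infinity>] upper eq by (simp add: hyp_tail_def)
  qed
  show ?thesis
    using add[of "ereal s" "ereal t1" "ereal t2"] unfolding tail K_def[symmetric]
    by (simp add: field_simps)
qed

text \<open>The tail lies on the side of the larger exponential term, which exceeds
  \<open>M / 2\<close>. The half-line bound in that term thus becomes a bound in the symmetric
  quantity \<open>M\<close>, which dominates a multiple of the squared norm.\<close>

lemma hyp_tail_bound:
  fixes t0 :: real
  assumes "k > 0" "X > 0" "Y > 0"
  defines "M \<equiv> X * exp (2 * t0) + Y * exp (- 2 * t0)"
  shows "\<bar>hyp_tail k X Y t0\<bar> \<le> exp (- k / 2 * M) / (k * M)"
proof -
  have M: "M > 0"
    using assms by (simp add: M_def add_pos_pos)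
  have mono: "exp (- k * Z) / (2 * k * Z) \<le> exp (- k / 2 * M) / (k * M)" if "2 * Z > M" for Z
  proof (rule frac_le)
    have "k * (2 * Z) \<ge> k * M"
      using that assms(1) by (intro mult_left_mono) auto
    then show "exp (- k * Z) \<le> exp (- k / 2 * M)" and "k * M \<le> 2 * k * Z"
      by (simp_all add: field_simps)
  qed (use assms(1) M in auto)
  consider "X * exp (2 * t0) > Y * exp (- 2 * t0)" | "X * exp (2 * t0) < Y * exp (- 2 * t0)"
    | "X * exp (2 * t0) = Y * exp (- 2 * t0)"
    by linarith
  then show ?thesis
  proof cases
    case 1
    then show ?thesis
      using hyp_gauss_tail_bound[of k X Y t0] mono[of "X * exp (2 * t0)"] assms
      by (simp add: hyp_tail_def)
  next
    case 2
    then show ?thesis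
      using hyp_gauss_tail_bound[of k Y X "- t0"] mono[of "Y * exp (- 2 * t0)"] assms
      by (simp add: hyp_tail_def interval_integral_hyp_gauss_reflect[of "-\<infinity>"])
  next
    case 3
    then show ?thesis
      using M assms by (simp add: hyp_tail_def)
  qed
qed

section \<open>Signs and wall crossing\<close>

lemma sgn_diff_times:
  fixes a b :: real
  shows "sgn (b - a) * (1 - sgn (a * b)) = sgn b - sgn a"
  by (auto simp: sgn_if zero_less_mult_iff)

text \<open>\<open>f\<close> is strictly increasing, so \<open>t2 - t1\<close> and
  \<open>f t2 - f t1\<close> have the same sign, and the difference of squares is \<open>f\<close>
  times a positive factor. As \<open>sgn 0 = 0\<close>, the identity includes zeros of
  \<open>f\<close>.\<close>

lemma sgn_wall_crossing:
  fixes t1 t2 X Y :: real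
  assumes "X > 0" "Y > 0"
  defines "f \<equiv> \<lambda>t. X * exp t - Y * exp (- t)"
  shows "sgn (t2 - t1) * (1 / 2 * (1 - sgn (f t1 * f t2))) =
    (sgn (X\<^sup>2 * exp (2 * t2) - Y\<^sup>2 * exp (- 2 * t2)) - sgn (X\<^sup>2 * exp (2 * t1) - Y\<^sup>2 * exp (- 2 * t1))) / 2"
proof -
  have mono: "f s < f t" if "s < t" for s t
    unfolding f_def using that assms by (intro diff_strict_mono) auto
  have "sgn (t2 - t1) = sgn (f t2 - f t1)"
    using mono[of t1 t2] mono[of t2 t1] by (cases t1 t2 rule: linorder_cases) auto
  moreover have "sgn (X\<^sup>2 * exp (2 * t) - Y\<^sup>2 * exp (- 2 * t)) = sgn (f t)" for t
  proof -
    have "X\<^sup>2 * exp (2 * t) - Y\<^sup>2 * exp (- 2 * t) = (X * exp t + Y * exp (- t)) * f t"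
      unfolding f_def using exp_double[of t] exp_double[of "-t"]
      by (simp add: power2_eq_square algebra_simps)
    moreover have "X * exp t + Y * exp (- t) > 0"
      using assms by (simp add: add_pos_pos)
    ultimately show ?thesis by (simp add: sgn_mult)
  qed
  ultimately show ?thesis
    using sgn_diff_times[of "f t2" "f t1"] by simp
qed

section \<open>Gaussian sums over a lattice coset and comparison\<close>

lemma summable_on_int_exp_abs:
  fixes c :: real
  assumes "c > 0"
  shows "(\<lambda>m::int. exp (- c * \<bar>real_of_int m\<bar>)) summable_on UNIV"
proof -
  let ?f = "\<lambda>m::int. exp (- c * \<bar>real_of_int m\<bar>)"
  have "summable (\<lambda>n. exp (- c) ^ n)"
    using assms by (intro summable_geometric) auto
  then have "(\<lambda>n::nat. exp (- c) ^ n) summable_on UNIV"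
    by (subst summable_on_UNIV_nonneg_real_iff) auto
  then have nat: "(\<lambda>n::nat. exp (- c * real n)) summable_on UNIV"
    by (simp add: exp_of_nat_mult[symmetric] mult.commute)
  have "?f summable_on (range int)" "?f summable_on (range (\<lambda>n. - int n))"
    using nat by (subst summable_on_reindex; simp add: o_def inj_def)+
  then have "?f summable_on (range int \<union> range (\<lambda>n. - int n))"
    by (rule summable_on_union)
  also have "range int \<union> range (\<lambda>n. - int n) = UNIV"
    by (auto simp: image_def) (metis int_cases2)
  finally show ?thesis .
qed

lemma summable_on_int_gaussian:
  fixes k a :: real
  assumes "k > 0"
  shows "(\<lambda>m::int. exp (- k * (a + real_of_int m)\<^sup>2)) summable_on UNIV"
proof (rule summable_on_comparison_test)
  \<comment> \<open>By \<open>x^2 >= 2 * abs x - 1\<close> and the triangle inequality,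
    \<open>(a + m)^2\<close> is at least \<open>2 * abs m\<close> minus the constant
    \<open>1 + 2 * abs a\<close>, which \<open>?C\<close> absorbs.\<close>
  let ?C = "exp (k * (1 + 2 * \<bar>a\<bar>))"
  show "(\<lambda>m::int. ?C * exp (- (2 * k) * \<bar>real_of_int m\<bar>)) summable_on UNIV"
    using assms by (intro summable_on_cmult_right summable_on_int_exp_abs) auto
  fix m :: int
  have "0 \<le> (\<bar>a + real_of_int m\<bar> - 1)\<^sup>2" by simp
  then have "(a + real_of_int m)\<^sup>2 \<ge> 2 * \<bar>a + real_of_int m\<bar> - 1"
    by (simp add: power2_diff)
  moreover have "2 * \<bar>a + real_of_int m\<bar> - 1 \<ge> 2 * \<bar>real_of_int m\<bar> - 2 * \<bar>a\<bar> - 1"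
    using abs_triangle_ineq[of "a + real_of_int m" "- a"] by simp
  ultimately have "(a + real_of_int m)\<^sup>2 \<ge> 2 * \<bar>real_of_int m\<bar> - 2 * \<bar>a\<bar> - 1"
    by (rule order.trans[rotated])
  then have "k * (a + real_of_int m)\<^sup>2 \<ge> k * (2 * \<bar>real_of_int m\<bar> - 2 * \<bar>a\<bar> - 1)"
    using assms by (intro mult_left_mono) auto
  then show "exp (- k * (a + real_of_int m)\<^sup>2) \<le> ?C * exp (- (2 * k) * \<bar>real_of_int m\<bar>)"
    by (simp add: algebra_simps flip: exp_add)
qed auto

lemma summable_on_lattice_coset_gaussian:
  fixes a :: "real^2"
  assumes "k > 0"
  shows "(\<lambda>\<nu>. exp (- k * (norm \<nu>)\<^sup>2)) summable_on lattice_coset a"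
proof -
  define h :: "int \<times> int \<Rightarrow> real^2" where
    "h = (\<lambda>(m, n). a + vector [real_of_int m, real_of_int n])"
  have inj: "inj h"
    by (auto simp: inj_def h_def vec_eq_iff forall_2)
  have "lattice_coset a \<subseteq> range h"
  proof
    fix \<nu> assume "\<nu> \<in> lattice_coset a"
    then obtain m where m: "\<nu> = a + m" "m $ 1 \<in> \<int>" "m $ 2 \<in> \<int>"
      by (auto simp: lattice_coset_def)
    then have "\<nu> = h (\<lfloor>m $ 1\<rfloor>, \<lfloor>m $ 2\<rfloor>)"
      by (auto simp: h_def vec_eq_iff forall_2)
    then show "\<nu> \<in> range h" by blast
  qed
  moreover have "(\<lambda>\<nu>. exp (- k * (norm \<nu>)\<^sup>2)) summable_on range h"
  proof (subst summable_on_reindex[OF inj])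
    let ?f = "\<lambda>i m. exp (- k * (a $ i + real_of_int m)\<^sup>2)"
    have "(\<lambda>(m, n). ?f 1 m * ?f 2 n) summable_on (UNIV \<times> UNIV)"
    proof (rule summable_on_SigmaI)
      fix m :: int
      show "((\<lambda>n. case (m, n) of (m, n) \<Rightarrow> ?f 1 m * ?f 2 n) has_sum
              (?f 1 m * infsum (?f 2) UNIV)) UNIV"
        using summable_on_int_gaussian[OF assms]
        by (auto intro!: has_sum_cmult_right)
    qed (use summable_on_int_gaussian[OF assms] in \<open>auto intro!: summable_on_cmult_left\<close>)
    also have "(\<lambda>(m, n). ?f 1 m * ?f 2 n) = (\<lambda>\<nu>. exp (- k * (norm \<nu>)\<^sup>2)) \<circ> h"
      by (auto simp: fun_eq_iff h_def norm_vec_def L2_set_def sum_2 algebra_simps simp flip: exp_add)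
    finally show "(\<lambda>\<nu>. exp (- k * (norm \<nu>)\<^sup>2)) \<circ> h summable_on UNIV" by (simp add: o_def)
  qed
  ultimately show ?thesis
    using summable_on_subset_banach by blast
qed

lemma finite_superlevel_summable:
  fixes g :: "'a \<Rightarrow> real"
  assumes g: "g summable_on A" "\<And>x. x \<in> A \<Longrightarrow> g x \<ge> 0" and "e > 0"
  shows "finite {x \<in> A. g x \<ge> e}"
proof (rule ccontr)
  assume "infinite {x \<in> A. g x \<ge> e}"
  moreover obtain n where n: "real n * e > infsum g A"
    using \<open>e > 0\<close> reals_Archimedean3 by blast
  ultimately obtain F where F: "finite F" "card F = n" "F \<subseteq> {x \<in> A. g x \<ge> e}"
    using infinite_arbitrarily_large by blast
  have "real n * e \<le> sum g F"
    using F sum_bounded_below[of F e g] by auto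
  also have "\<dots> \<le> infsum g A"
    using F g by (intro finite_sum_le_infsum) auto
  finally show False using n by simp
qed

text \<open>Only finitely many points have \<open>g x >= e\<close>, so a bound where
  \<open>g\<close> is small suffices. This suits the tail estimate, whose factor
  \<open>1 / M\<close> is harmless only away from \<open>M = 0\<close>.\<close>

lemma abs_summable_on_comparison_small:
  fixes g :: "'a \<Rightarrow> real" and f :: "'a \<Rightarrow> 'b::banach"
  assumes g: "g summable_on A" "\<And>x. x \<in> A \<Longrightarrow> g x \<ge> 0" and "e > 0"
    and le: "\<And>x. x \<in> A \<Longrightarrow> g x < e \<Longrightarrow> norm (f x) \<le> C * g x"
  shows "(\<lambda>x. norm (f x)) summable_on A"
proof -
  let ?F = "{x \<in> A. g x \<ge> e}"
  have "g summable_on (A - ?F)"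
    using g(1) by (rule summable_on_subset_banach) auto
  then have "(\<lambda>x. norm (f x)) summable_on (A - ?F)"
    by (rule Infinite_Sum.abs_summable_on_comparison_test'[OF summable_on_cmult_right]) (use le in force)
  moreover have "(\<lambda>x. norm (f x)) summable_on ?F"
    using finite_superlevel_summable[OF g \<open>e > 0\<close>] by (rule summable_on_finite)
  ultimately have "(\<lambda>x. norm (f x)) summable_on ((A - ?F) \<union> ?F)"
    by (rule summable_on_union)
  moreover have "(A - ?F) \<union> ?F = A" by auto
  ultimately show ?thesis by simp
qed

section \<open>The quadratic form in the coordinates given by \<open>P\<close>\<close>

lemma norm_e2pi [simp]: "norm (e2pi r) = 1"
  by (simp add: e2pi_def)

lemma qpow_eq_e2pi: "qpow \<tau> r = e2pi (r * Re \<tau>) * of_real (exp (- 2 * pi * Im \<tau> * r))"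
  unfolding qpow_def e2pi_def exp_of_real[symmetric] exp_add[symmetric]
  by (rule arg_cong[where f = exp]) (simp add: complex_eq_iff)

lemma bilin_coords:
  assumes "map_matrix real_of_int A = transpose P ** hyp_matrix ** P"
  shows "bilin A \<nu> \<mu> = (P *v \<nu>) $ 1 * (P *v \<mu>) $ 2 + (P *v \<nu>) $ 2 * (P *v \<mu>) $ 1"
proof -
  have "bilin A \<nu> \<mu> = \<nu> \<bullet> (transpose P *v (hyp_matrix *v (P *v \<mu>)))"
    by (simp add: bilin_def assms matrix_vector_mul_assoc matrix_mul_assoc)
  also have "\<dots> = (P *v \<nu>) \<bullet> (hyp_matrix *v (P *v \<mu>))"
    by (metis dot_lmul_matrix inner_commute transpose_matrix_vector)
  finally show ?thesis
    by (simp add: inner_vec_def sum_2 hyp_matrix_def matrix_vector_mult_def)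
qed

lemma quad_coords:
  assumes "map_matrix real_of_int A = transpose P ** hyp_matrix ** P"
  shows "quad A \<nu> = (P *v \<nu>) $ 1 * (P *v \<nu>) $ 2"
  using bilin_coords[OF assms, of \<nu> \<nu>] by (simp add: bilin_def quad_def)

lemma matrix_mult_inv_vector:
  assumes "invertible (P :: real^'n^'n)"
  shows "P *v (matrix_inv P *v x) = x" "matrix_inv P *v (P *v x) = x"
proof -
  have "P ** matrix_inv P = mat 1 \<and> matrix_inv P ** P = mat 1"
    using assms unfolding invertible_def matrix_inv_def by (rule someI_ex)
  then show "P *v (matrix_inv P *v x) = x" "matrix_inv P *v (P *v x) = x"
    by (simp_all add: matrix_vector_mul_assoc)
qed

lemma bilin_curves:
  assumes "map_matrix real_of_int A = transpose P ** hyp_matrix ** P" "invertible P"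
  shows "bilin A \<nu> (c_curve P t) = (P *v \<nu>) $ 2 * exp t - (P *v \<nu>) $ 1 * exp (- t)"
    and "bilin A \<nu> (c_perp_curve P t) = (P *v \<nu>) $ 2 * exp t + (P *v \<nu>) $ 1 * exp (- t)"
  by (simp_all add: bilin_coords[OF assms(1)] c_curve_def c_perp_curve_def
      matrix_mult_inv_vector[OF assms(2)])

lemma c_param_c_curve:
  assumes "invertible P"
  shows "c_param P (c_curve P t) = t"
  unfolding c_param_def
proof (rule the_equality)
  fix s assume "c_curve P s = c_curve P t"
  then have "(P *v c_curve P s) $ 1 = (P *v c_curve P t) $ 1" by simp
  then show "s = t"
    by (simp add: c_curve_def matrix_mult_inv_vector[OF assms])
qed simp

text \<open>On \<open>Q = -1\<close> the first coordinate of \<open>P c\<close> cannot vanish. It is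
  1 at the base point, so connectedness keeps it positive on \<open>C\<close>, and its logarithm is
  the parameter.\<close>

lemma component_c_curve:
  assumes A: "map_matrix real_of_int A = transpose P ** hyp_matrix ** P" and P: "invertible P"
    and C: "C \<in> components {c. quad A c = -1}" "matrix_inv P *v vector [1, -1] \<in> C" "c \<in> C"
  obtains t where "c = c_curve P t"
proof -
  let ?f = "\<lambda>c. (P *v c) $ 1"
  have "connected C" using C in_components_connected by blast
  then have conn: "connected (?f ` C)"
    by (intro connected_continuous_image continuous_intros matrix_vector_mult_linear_continuous_on)
  have q: "?f x * (P *v x) $ 2 = -1" if "x \<in> C" for x
    using in_components_subset[OF C(1)] that quad_coords[OF A] by auto
  then have "0 \<notin> ?f ` C" by force
  moreover have "1 \<in> ?f ` C"
    using C(2) by (auto intro!: image_eqI simp: matrix_mult_inv_vector[OF P])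
  ultimately have pos: "?f c > 0"
    using connectedD_interval[OF conn, of "?f c" 1 0] C(3) by force
  then have "(P *v c) $ 2 = - exp (- ln (?f c))"
    using q[OF C(3)] by (simp add: exp_minus field_simps)
  then have "P *v c = vector [exp (ln (?f c)), - exp (- ln (?f c))]"
    using pos by (simp add: vec_eq_iff forall_2)
  then have "c = c_curve P (ln (?f c))"
    unfolding c_curve_def by (metis matrix_mult_inv_vector(2)[OF P])
  then show ?thesis using that by blast
qed

text \<open>An injective linear map is bounded below, and both exponential factors are at least
  \<open>exp (- 2 * T)\<close>. Uniformity in \<open>t\<close> is what integration over a compact
  interval requires.\<close>

lemma majorant_lower_bound:
  assumes P: "invertible (P :: real^2^2)"
  obtains \<delta> where "\<delta> > 0"
    "\<And>\<nu> t. \<bar>t\<bar> \<le> T \<Longrightarrow>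
      ((P *v \<nu>) $ 2)\<^sup>2 * exp (2 * t) + ((P *v \<nu>) $ 1)\<^sup>2 * exp (- 2 * t) \<ge> \<delta> * (norm (\<nu>::real^2))\<^sup>2"
proof -
  have "inj ((*v) P)"
    using P matrix_mult_inv_vector(2)[OF P] by (metis injI)
  then obtain B where B: "B > 0" "\<And>\<nu>. B * norm \<nu> \<le> norm (P *v \<nu>)"
    using linear_inj_bounded_below_pos[of "(*v) P"] by (auto simp: mult.commute)
  show ?thesis
  proof
    show "exp (- 2 * T) * B\<^sup>2 > 0" using B by simp
    fix \<nu> :: "real^2" and t :: real assume t: "\<bar>t\<bar> \<le> T"
    have "exp (- 2 * T) * B\<^sup>2 * (norm \<nu>)\<^sup>2 = exp (- 2 * T) * (B * norm \<nu>)\<^sup>2"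
      by (simp add: power_mult_distrib)
    also have "\<dots> \<le> exp (- 2 * T) * (norm (P *v \<nu>))\<^sup>2"
      using B by (intro mult_left_mono power_mono) auto
    also have "\<dots> = ((P *v \<nu>) $ 2)\<^sup>2 * exp (- 2 * T) + ((P *v \<nu>) $ 1)\<^sup>2 * exp (- 2 * T)"
      by (simp add: norm_vec_def L2_set_def sum_2 algebra_simps)
    also have "\<dots> \<le> ((P *v \<nu>) $ 2)\<^sup>2 * exp (2 * t) + ((P *v \<nu>) $ 1)\<^sup>2 * exp (- 2 * t)"
      using t by (intro add_mono mult_left_mono) auto
    finally show "exp (- 2 * T) * B\<^sup>2 * (norm \<nu>)\<^sup>2 \<le>
      ((P *v \<nu>) $ 2)\<^sup>2 * exp (2 * t) + ((P *v \<nu>) $ 1)\<^sup>2 * exp (- 2 * t)" .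
  qed
qed

section \<open>Integrands, tails and coefficients in coordinates\<close>

text \<open>The cross term of the squared bilinear form is \<open>- 2 * Q\<close>, constant in
  \<open>t\<close>.\<close>

lemma exp_bilin_c_curve:
  assumes "map_matrix real_of_int A = transpose P ** hyp_matrix ** P" "invertible P"
  shows "exp (- pi * y * (bilin A \<nu> (c_curve P t))\<^sup>2) =
    exp (2 * pi * y * quad A \<nu>) * hyp_gauss (pi * y) (((P *v \<nu>) $ 2)\<^sup>2) (((P *v \<nu>) $ 1)\<^sup>2) t"
proof -
  define u v where "u = (P *v \<nu>) $ 1" and "v = (P *v \<nu>) $ 2"
  have "(v * exp t - u * exp (- t))\<^sup>2 = v\<^sup>2 * exp (2 * t) + u\<^sup>2 * exp (- 2 * t) - 2 * (u * v)"
    using exp_double[of t] exp_double[of "- t"]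
    by (simp add: power2_diff power_mult_distrib exp_minus)
  then have "- pi * y * (v * exp t - u * exp (- t))\<^sup>2 =
      2 * pi * y * (u * v) + - (pi * y) * (v\<^sup>2 * exp (2 * t) + u\<^sup>2 * exp (- 2 * t))"
    by (simp only:) (simp add: algebra_simps)
  then show ?thesis
    unfolding bilin_curves[OF assms] quad_coords[OF assms(1)] hyp_gauss_def u_def v_def exp_add[symmetric]
    by (rule arg_cong)
qed

lemma alpha_eq_hyp_tail:
  assumes A: "map_matrix real_of_int A = transpose P ** hyp_matrix ** P" and P: "invertible P"
    and y: "y > 0"
  shows "alpha A P t (sqrt y *\<^sub>R \<nu>) =
    exp (2 * pi * y * quad A \<nu>) * hyp_tail (pi * y) (((P *v \<nu>) $ 2)\<^sup>2) (((P *v \<nu>) $ 1)\<^sup>2) t"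
proof -
  define u v where "u = (P *v \<nu>) $ 1" and "v = (P *v \<nu>) $ 2"
  have sc: "bilin A (sqrt y *\<^sub>R \<nu>) \<mu> = sqrt y * bilin A \<nu> \<mu>" for \<mu>
    by (simp add: bilin_def)
  have "exp (- pi * (bilin A (sqrt y *\<^sub>R \<nu>) (c_curve P s))\<^sup>2) =
      exp (2 * pi * y * quad A \<nu>) * hyp_gauss (pi * y) (v\<^sup>2) (u\<^sup>2) s" for s
    using exp_bilin_c_curve[OF A P, of y \<nu> s] y
    by (simp add: sc power_mult_distrib u_def v_def algebra_simps)
  moreover have "bilin A (sqrt y *\<^sub>R \<nu>) (c_curve P t) * bilin A (sqrt y *\<^sub>R \<nu>) (c_perp_curve P t) =
      y * (v\<^sup>2 * exp (2 * t) - u\<^sup>2 * exp (- 2 * t))"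
  proof -
    have "(sqrt y * (v * exp t - u * exp (- t))) * (sqrt y * (v * exp t + u * exp (- t))) =
        (sqrt y)\<^sup>2 * (v\<^sup>2 * (exp t)\<^sup>2 - u\<^sup>2 * (exp (- t))\<^sup>2)"
      by algebra
    then show ?thesis
      using exp_double[of t] exp_double[of "- t"] y
      unfolding sc unfolding bilin_curves[OF A P] u_def v_def by simp
  qed
  ultimately show ?thesis
    using y unfolding alpha_def hyp_tail_def Let_def u_def[symmetric] v_def[symmetric]
    by (simp add: zero_less_mult_iff mult_less_0_iff)
qed

text \<open>Up to the common factor \<open>sgn v\<close>, one of the two bilinear values is the
  increasing function \<open>f\<close> and the other the positive function \<open>g\<close>; the
  sign of \<open>Q\<close> decides which. Only \<open>f\<close> changes sign, so only one
  coefficient survives.\<close>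

lemma wall_crossing_coefficients:
  assumes A: "map_matrix real_of_int A = transpose P ** hyp_matrix ** P" and P: "invertible P"
    and Q: "quad A \<nu> \<noteq> 0"
  defines "u \<equiv> (P *v \<nu>) $ 1" and "v \<equiv> (P *v \<nu>) $ 2"
  defines "D \<equiv> \<lambda>t. sgn (v\<^sup>2 * exp (2 * t) - u\<^sup>2 * exp (- 2 * t))"
  shows "sgn (t2 - t1) * (1 / 2 * (1 - sgn (bilin A \<nu> (c_curve P t1) * bilin A \<nu> (c_curve P t2)))) =
           (if quad A \<nu> > 0 then (D t2 - D t1) / 2 else 0)" (is ?curve)
    and "sgn (t2 - t1) * (1 / 2 * (1 - sgn (bilin A \<nu> (c_perp_curve P t1) * bilin A \<nu> (c_perp_curve P t2)))) =
           (if quad A \<nu> < 0 then (D t2 - D t1) / 2 else 0)" (is ?perp)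
proof -
  define f g where "f = (\<lambda>t. \<bar>v\<bar> * exp t - \<bar>u\<bar> * exp (- t))"
    and "g = (\<lambda>t. \<bar>v\<bar> * exp t + \<bar>u\<bar> * exp (- t))"
  have quad: "quad A \<nu> = u * v"
    by (simp add: quad_coords[OF A] u_def v_def)
  with Q have nz: "u \<noteq> 0" "v \<noteq> 0" by auto
  have curve: "bilin A \<nu> (c_curve P t) = v * exp t - u * exp (- t)"
    and perp: "bilin A \<nu> (c_perp_curve P t) = v * exp t + u * exp (- t)" for t
    by (simp_all add: bilin_curves[OF A P] u_def v_def)
  have f: "sgn (t2 - t1) * (1 / 2 * (1 - sgn (f t1 * f t2))) = (D t2 - D t1) / 2"
    using sgn_wall_crossing[of "\<bar>v\<bar>" "\<bar>u\<bar>" t2 t1] nz by (simp add: f_def D_def)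
  have "g t > 0" for t
    using nz by (simp add: g_def add_pos_pos)
  then have g: "sgn (g t1 * g t2) = 1"
    by simp
  have "?curve \<and> ?perp"
  proof (cases "u * v > 0")
    case True
    then have u: "u = sgn v * \<bar>u\<bar>" and v: "v = sgn v * \<bar>v\<bar>" and s: "sgn v * sgn v = 1"
      by (auto simp: sgn_if zero_less_mult_iff)
    have "v * exp t - u * exp (- t) = sgn v * f t" "v * exp t + u * exp (- t) = sgn v * g t" for t
      by (subst (1) u, subst (1) v, simp add: f_def g_def algebra_simps)+
    then have "bilin A \<nu> (c_curve P t1) * bilin A \<nu> (c_curve P t2) = f t1 * f t2"
      "bilin A \<nu> (c_perp_curve P t1) * bilin A \<nu> (c_perp_curve P t2) = g t1 * g t2"
      using s by (simp_all add: curve perp)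
    then show ?thesis using f g True quad by simp
  next
    case False
    then have neg: "u * v < 0" using Q quad by (metis less_linear)
    then have u: "u = - sgn v * \<bar>u\<bar>" and v: "v = sgn v * \<bar>v\<bar>" and s: "sgn v * sgn v = 1"
      by (auto simp: sgn_if mult_less_0_iff)
    have "v * exp t - u * exp (- t) = sgn v * g t" "v * exp t + u * exp (- t) = sgn v * f t" for t
      by (subst (1) u, subst (1) v, simp add: f_def g_def algebra_simps)+
    then have "bilin A \<nu> (c_curve P t1) * bilin A \<nu> (c_curve P t2) = g t1 * g t2"
      "bilin A \<nu> (c_perp_curve P t1) * bilin A \<nu> (c_perp_curve P t2) = f t1 * f t2"
      using s by (simp_all add: curve perp)
    then show ?thesis using f g neg quad by simp
  qed
  then show ?curve ?perp by blast+
qed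

section \<open>Absolute convergence\<close>

lemma abs_summable_hyp_tail:
  assumes A: "map_matrix real_of_int A = transpose P ** hyp_matrix ** P" and P: "invertible P"
    and Q: "\<forall>\<nu>\<in>lattice_coset a. quad A \<nu> \<noteq> 0" and k: "k > 0"
  shows "(\<lambda>\<nu>. norm (hyp_tail k (((P *v \<nu>) $ 2)\<^sup>2) (((P *v \<nu>) $ 1)\<^sup>2) t)) summable_on lattice_coset a"
proof -
  define M where "M = (\<lambda>\<nu>. ((P *v \<nu>) $ 2)\<^sup>2 * exp (2 * t) + ((P *v \<nu>) $ 1)\<^sup>2 * exp (- 2 * t))"
  obtain \<delta> where \<delta>: "\<delta> > 0" "\<And>\<nu>. M \<nu> \<ge> \<delta> * (norm \<nu>)\<^sup>2"
    using majorant_lower_bound[OF P, of "\<bar>t\<bar>"] unfolding M_def by (metis order_refl)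
  show ?thesis
  \<comment> \<open>The threshold is the value of the Gaussian at \<open>M = 1\<close>; below it
    \<open>M > 1\<close>, so \<open>1 / (k * M)\<close> is at most \<open>1 / k\<close>.\<close>
  proof (rule abs_summable_on_comparison_small[where C = "1 / k" and e = "exp (- k / 2)"])
    show "(\<lambda>\<nu>. exp (- k / 2 * M \<nu>)) summable_on lattice_coset a"
    proof (rule summable_on_comparison_test)
      show "(\<lambda>\<nu>. exp (- (k / 2 * \<delta>) * (norm \<nu>)\<^sup>2)) summable_on lattice_coset a"
        using k \<delta> by (intro summable_on_lattice_coset_gaussian) auto
      show "exp (- k / 2 * M \<nu>) \<le> exp (- (k / 2 * \<delta>) * (norm \<nu>)\<^sup>2)" for \<nu>
        using mult_left_mono[OF \<delta>(2)[of \<nu>], of "k / 2"] k by (simp add: mult.assoc)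
    qed auto
    fix \<nu> assume \<nu>: "\<nu> \<in> lattice_coset a" and "exp (- k / 2 * M \<nu>) < exp (- k / 2)"
    then have "M \<nu> > 1" using k by (simp add: field_simps)
    have "(P *v \<nu>) $ 1 \<noteq> 0" "(P *v \<nu>) $ 2 \<noteq> 0"
      using Q \<nu> by (auto simp: quad_coords[OF A])
    then have "\<bar>hyp_tail k (((P *v \<nu>) $ 2)\<^sup>2) (((P *v \<nu>) $ 1)\<^sup>2) t\<bar> \<le> exp (- k / 2 * M \<nu>) / (k * M \<nu>)"
      using k unfolding M_def by (intro hyp_tail_bound) auto
    also have "\<dots> \<le> exp (- k / 2 * M \<nu>) / k"
      using \<open>M \<nu> > 1\<close> k by (intro divide_left_mono) auto
    finally show "norm (hyp_tail k (((P *v \<nu>) $ 2)\<^sup>2) (((P *v \<nu>) $ 1)\<^sup>2) t)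
        \<le> 1 / k * exp (- k / 2 * M \<nu>)" by simp
  qed auto
qed

lemma abs_summable_hyp_gauss_integral:
  assumes P: "invertible (P :: real^2^2)" and k: "k > 0"
  shows "(\<lambda>\<nu>. norm (LBINT t=ereal t1..ereal t2. hyp_gauss k (((P *v \<nu>) $ 2)\<^sup>2) (((P *v \<nu>) $ 1)\<^sup>2) t))
           summable_on lattice_coset a"
proof -
  \<comment> \<open>Bounds every point between \<open>t1\<close> and \<open>t2\<close>, whichever is
    larger.\<close>
  define T where "T = \<bar>t1\<bar> + \<bar>t2\<bar>"
  define h where "h \<nu> = hyp_gauss k (((P *v \<nu>) $ 2)\<^sup>2) (((P *v \<nu>) $ 1)\<^sup>2)" for \<nu>
  obtain \<delta> where \<delta>: "\<delta> > 0" "\<And>\<nu> t. \<bar>t\<bar> \<le> T \<Longrightarrow>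
      ((P *v \<nu>) $ 2)\<^sup>2 * exp (2 * t) + ((P *v \<nu>) $ 1)\<^sup>2 * exp (- 2 * t) \<ge> \<delta> * (norm \<nu>)\<^sup>2"
    using majorant_lower_bound[OF P, of T] by blast
  have bound: "norm (h \<nu> t) \<le> exp (- (k * \<delta>) * (norm \<nu>)\<^sup>2)" if "\<bar>t\<bar> \<le> T" for \<nu> t
    using mult_left_mono[OF \<delta>(2)[OF that, of \<nu>], of k] k
    by (simp add: h_def hyp_gauss_def mult.assoc)
  have le: "norm (LBINT t=ereal r..ereal s. h \<nu> t) \<le> (s - r) * exp (- (k * \<delta>) * (norm \<nu>)\<^sup>2)"
    if "r \<le> s" "\<bar>r\<bar> \<le> T" "\<bar>s\<bar> \<le> T" for r s \<nu>
  proof -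
    have "(LBINT t=ereal r..ereal s. h \<nu> t) = integral {r..s} (h \<nu>)"
      using that unfolding h_def
      by (intro interval_integral_eq_integral borel_integrable_atLeastAtMost'
            continuous_on_hyp_gauss)
    also have "norm \<dots> \<le> exp (- (k * \<delta>) * (norm \<nu>)\<^sup>2) * (s - r)"
      using that bound unfolding h_def
      by (intro integral_bound continuous_on_hyp_gauss) auto
    finally show ?thesis by (simp add: mult.commute)
  qed
  show ?thesis
  proof (rule Infinite_Sum.abs_summable_on_comparison_test')
    show "(\<lambda>\<nu>. \<bar>t2 - t1\<bar> * exp (- (k * \<delta>) * (norm \<nu>)\<^sup>2)) summable_on lattice_coset a"
      using k \<delta> by (intro summable_on_cmult_right summable_on_lattice_coset_gaussian) auto
    fix \<nu>
    show "norm (LBINT t=ereal t1..ereal t2. hyp_gauss k (((P *v \<nu>) $ 2)\<^sup>2) (((P *v \<nu>) $ 1)\<^sup>2) t)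
      \<le> \<bar>t2 - t1\<bar> * exp (- (k * \<delta>) * (norm \<nu>)\<^sup>2)"
      using le[of t1 t2 \<nu>] le[of t2 t1 \<nu>] interval_integral_endpoints_reverse[of t1 t2 "h \<nu>"]
      by (cases "t1 \<le> t2") (auto simp: T_def simp flip: h_def)
  qed
qed

section \<open>Summation of the termwise identity\<close>

theorem theorem2:
  fixes A :: "int^2^2" and P :: "real^2^2" and C\<^sub>Q :: "(real^2) set"
    and a b c1 c2 :: "real^2"
  assumes "transpose A = A"
    and "has_signature (quad A) 1 1"
    and "C\<^sub>Q \<in> components {c. quad A c = -1}"
    and "invertible P"
    and "map_matrix real_of_int A = transpose P ** hyp_matrix ** P"
    and "matrix_inv P *v vector [1, -1] \<in> C\<^sub>Q"
    and "c1 \<in> C\<^sub>Q" and "c2 \<in> C\<^sub>Q"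
    and "\<forall>\<nu>\<in>lattice_coset a. quad A \<nu> \<noteq> 0"
  shows "\<forall>\<tau>. Im \<tau> > 0 \<longrightarrow>
           Phi_hat A P a b c1 c2 \<tau> = Phi A P a b c1 c2 \<tau> + phi A P a b c1 \<tau> - phi A P a b c2 \<tau>"
proof (intro allI impI)
  fix \<tau> :: complex assume y: "Im \<tau> > 0"
  note P = assms(4) and A = assms(5) and Q = assms(9)
  obtain t1 t2 where c: "c1 = c_curve P t1" "c2 = c_curve P t2"
    using component_c_curve[OF A P assms(3,6)] assms(7,8) by metis
  have cp: "c_param P c1 = t1" "c_param P c2 = t2"
    "c_perp P c1 = c_perp_curve P t1" "c_perp P c2 = c_perp_curve P t2"
    by (simp_all add: c c_perp_def c_param_c_curve[OF P])
  define L where "L = lattice_coset a"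
  define k where "k = pi * Im \<tau>"
  have k: "k > 0" using y by (simp add: k_def)
  define X Y where "X = (\<lambda>\<nu>. ((P *v \<nu>) $ 2)\<^sup>2)" and "Y = (\<lambda>\<nu>. ((P *v \<nu>) $ 1)\<^sup>2)"
  define D where "D = (\<lambda>\<nu> t. sgn (X \<nu> * exp (2 * t) - Y \<nu> * exp (- 2 * t)))"
  define E where "E = (\<lambda>\<nu>. e2pi (quad A \<nu> * Re \<tau>) * e2pi (bilin A \<nu> b))"
  define I where "I = (\<lambda>\<nu>. LBINT t=ereal t1..ereal t2. hyp_gauss k (X \<nu>) (Y \<nu>) t)"
  define J where "J = (\<lambda>t \<nu>. hyp_tail k (X \<nu>) (Y \<nu>) t)"
  \<comment> \<open>The absolute value unifies the two Bessel arguments; \<open>K1\<close> and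
    \<open>K2\<close> are the parts of \<open>K\<close> on the two signs of
    \<open>Q\<close>.\<close>
  define K where "K = (\<lambda>\<nu>. (D \<nu> t2 - D \<nu> t1) / 2 * bessel_K0 (2 * k * \<bar>quad A \<nu>\<bar>))"
  define K1 where "K1 = (\<lambda>\<nu>. if quad A \<nu> > 0 then K \<nu> else 0)"
  define K2 where "K2 = (\<lambda>\<nu>. if quad A \<nu> < 0 then K \<nu> else 0)"
  define S where "S = (\<lambda>f. \<Sum>\<^sub>\<infinity>\<nu>\<in>L. E \<nu> * complex_of_real (f \<nu>))"

  have weight: "(LBINT t=ereal t1..ereal t2. exp (- pi * Im \<tau> * (bilin A \<nu> (c_curve P t))\<^sup>2)) =
      exp (2 * pi * Im \<tau> * quad A \<nu>) * I \<nu>" for \<nu>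
    unfolding exp_bilin_c_curve[OF A P] interval_lebesgue_integral_mult_right
    by (simp add: I_def X_def Y_def k_def)
  \<comment> \<open>The factor \<open>exp (2 * pi * y * Q)\<close> cancels the modulus of the power
    of \<open>q\<close>, leaving the phase \<open>E\<close> of modulus 1.\<close>
  have hat: "Phi_hat A P a b c1 c2 \<tau> = of_real (sqrt (Im \<tau>)) * S I"
    unfolding Phi_hat_def cp weight S_def L_def qpow_eq_e2pi
    by (rule arg_cong2[where f = "(*)", OF refl], rule infsum_cong)
       (simp add: E_def exp_minus field_simps)
  have phi: "phi A P a b (c_curve P t) \<tau> = of_real (sqrt (Im \<tau>)) * S (J t)" for t
    unfolding phi_def c_param_c_curve[OF P] S_def L_def alpha_eq_hyp_tail[OF A P y] qpow_eq_e2pi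
    by (rule arg_cong2[where f = "(*)", OF refl], rule infsum_cong)
       (simp add: E_def J_def X_def Y_def k_def exp_minus field_simps)
  have Phi: "Phi A P a b c1 c2 \<tau> = of_real (sqrt (Im \<tau>)) * S K1 + of_real (sqrt (Im \<tau>)) * S K2"
  proof -
    define s where "s = complex_of_real (sgn (t2 - t1))"
    have collect: "s * (of_real p * e * e' * of_real r) = e * e' * of_real z"
      if "sgn (t2 - t1) * p * r = z" for p r z e e'
      unfolding that[symmetric] s_def by simp
    have first: "s * (\<Sum>\<^sub>\<infinity>\<nu>\<in>L.
          of_real (1 / 2 * (1 - sgn (bilin A \<nu> c1 * bilin A \<nu> c2))) *
          e2pi (quad A \<nu> * Re \<tau>) * e2pi (bilin A \<nu> b) *
          of_real (bessel_K0 (2 * pi * quad A \<nu> * Im \<tau>))) = S K1"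
      unfolding S_def infsum_cmult_right'[symmetric]
    proof (rule infsum_cong)
      fix \<nu> assume "\<nu> \<in> L"
      then have "quad A \<nu> \<noteq> 0" using Q by (simp add: L_def)
      note coeff = wall_crossing_coefficients(1)[OF A P this, of t2 t1]
      have "sgn (t2 - t1) * (1 / 2 * (1 - sgn (bilin A \<nu> c1 * bilin A \<nu> c2))) *
          bessel_K0 (2 * pi * quad A \<nu> * Im \<tau>) = K1 \<nu>"
        unfolding c coeff by (simp add: K1_def K_def D_def X_def Y_def k_def mult_ac)
      then show "s * (of_real (1 / 2 * (1 - sgn (bilin A \<nu> c1 * bilin A \<nu> c2))) *
          e2pi (quad A \<nu> * Re \<tau>) * e2pi (bilin A \<nu> b) *
          of_real (bessel_K0 (2 * pi * quad A \<nu> * Im \<tau>))) = E \<nu> * of_real (K1 \<nu>)"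
        unfolding E_def by (rule collect)
    qed
    have second: "s * (\<Sum>\<^sub>\<infinity>\<nu>\<in>L.
          of_real (1 / 2 * (1 - sgn (bilin A \<nu> (c_perp P c1) * bilin A \<nu> (c_perp P c2)))) *
          e2pi (quad A \<nu> * Re \<tau>) * e2pi (bilin A \<nu> b) *
          of_real (bessel_K0 (- 2 * pi * quad A \<nu> * Im \<tau>))) = S K2"
      unfolding S_def infsum_cmult_right'[symmetric]
    proof (rule infsum_cong)
      fix \<nu> assume "\<nu> \<in> L"
      then have "quad A \<nu> \<noteq> 0" using Q by (simp add: L_def)
      note coeff = wall_crossing_coefficients(2)[OF A P this, of t2 t1]
      have "sgn (t2 - t1) * (1 / 2 * (1 - sgn (bilin A \<nu> (c_perp P c1) * bilin A \<nu> (c_perp P c2)))) *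
          bessel_K0 (- 2 * pi * quad A \<nu> * Im \<tau>) = K2 \<nu>"
        unfolding cp coeff by (simp add: K2_def K_def D_def X_def Y_def k_def mult_ac)
      then show "s * (of_real (1 / 2 * (1 - sgn (bilin A \<nu> (c_perp P c1) * bilin A \<nu> (c_perp P c2)))) *
          e2pi (quad A \<nu> * Re \<tau>) * e2pi (bilin A \<nu> b) *
          of_real (bessel_K0 (- 2 * pi * quad A \<nu> * Im \<tau>))) = E \<nu> * of_real (K2 \<nu>)"
        unfolding E_def by (rule collect)
    qed
    show ?thesis
      unfolding first[symmetric] second[symmetric]
      unfolding Phi_def cp(1,2) s_def L_def of_real_mult by (simp only: mult_ac)
  qed

  have K_eq: "K \<nu> = I \<nu> - J t1 \<nu> + J t2 \<nu>" and K_split: "K \<nu> = K1 \<nu> + K2 \<nu>" if "\<nu> \<in> L" for \<nu>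
  proof -
    have nz: "quad A \<nu> \<noteq> 0" using that Q by (simp add: L_def)
    then show "K \<nu> = K1 \<nu> + K2 \<nu>" by (auto simp: K1_def K2_def)
    from nz have "X \<nu> > 0" "Y \<nu> > 0"
      by (auto simp: quad_coords[OF A] X_def Y_def)
    moreover have "sqrt (X \<nu> * Y \<nu>) = \<bar>quad A \<nu>\<bar>"
      by (simp add: quad_coords[OF A] X_def Y_def real_sqrt_mult abs_mult)
    ultimately show "K \<nu> = I \<nu> - J t1 \<nu> + J t2 \<nu>"
      using interval_integral_eq_hyp_tail[OF k, of "X \<nu>" "Y \<nu>" t1 t2]
      by (simp add: K_def I_def J_def D_def)
  qed
  have I: "(\<lambda>x. norm (I x)) summable_on L" and J: "(\<lambda>x. norm (J t x)) summable_on L" for t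
    unfolding I_def J_def X_def Y_def L_def
    by (intro abs_summable_hyp_gauss_integral[OF P k] abs_summable_hyp_tail[OF A P Q k])+
  \<comment> \<open>By \<open>K_eq\<close> this sum dominates \<open>K\<close>, so the Bessel series
    converge without any estimate of \<open>bessel_K0\<close>.\<close>
  have "(\<lambda>\<nu>. norm (I \<nu>) + norm (J t1 \<nu>) + norm (J t2 \<nu>)) summable_on L"
    by (intro summable_on_add I J)
  then have Ks: "(\<lambda>x. norm (K1 x)) summable_on L" "(\<lambda>x. norm (K2 x)) summable_on L"
    by (rule Infinite_Sum.abs_summable_on_comparison_test'; use K_eq in \<open>force simp: K1_def K2_def\<close>)+
  have summable: "(\<lambda>\<nu>. E \<nu> * complex_of_real (f \<nu>)) summable_on L" if "(\<lambda>x. norm (f x)) summable_on L" for f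
    by (rule abs_summable_summable) (use that in \<open>simp add: E_def norm_mult\<close>)
  \<comment> \<open>Arranged with plus signs only, so that additivity of convergent sums splits both
    sides.\<close>
  have "S (\<lambda>\<nu>. I \<nu> + J t2 \<nu>) = S (\<lambda>\<nu>. K1 \<nu> + K2 \<nu> + J t1 \<nu>)"
    unfolding S_def
  proof (rule infsum_cong)
    fix \<nu> assume "\<nu> \<in> L"
    then have "I \<nu> + J t2 \<nu> = K1 \<nu> + K2 \<nu> + J t1 \<nu>"
      using K_eq[of \<nu>] K_split[of \<nu>] by simp
    then show "E \<nu> * of_real (I \<nu> + J t2 \<nu>) = E \<nu> * of_real (K1 \<nu> + K2 \<nu> + J t1 \<nu>)"
      by simp
  qed
  then have "S I + S (J t2) = S K1 + S K2 + S (J t1)"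
    unfolding S_def
    by (simp add: distrib_left infsum_add summable_on_add summable I J Ks del: real_norm_def)
  then have "S I = S K1 + S K2 + S (J t1) - S (J t2)"
    by (simp add: algebra_simps)
  then show "Phi_hat A P a b c1 c2 \<tau> = Phi A P a b c1 c2 \<tau> + phi A P a b c1 \<tau> - phi A P a b c2 \<tau>"
    unfolding hat Phi unfolding c phi by (simp add: ring_distribs)
qed

end
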